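(* Let $M$ be a simple binary supersolvable matroid of rank $r$ with an $M$-partition $\mathcal P=P_1\uplus\dots\uplus P_r$. Then the S-graph $G_{\mathcal P}$ is chordal.
   Context: Matroids are finite on ground set $[n]$; simple means all circuits have at least three elements; binary means the symmetric difference of any two different circuits is a union of disjoint circuits. A pair of flats $F,F'$ is modular if $r(F)+r(F')=r(F\vee F')+r(F\wedge F')$; a flat is modular if it forms a modular pair with every flat. $M$ of rank $r$ is supersolvable if there is a maximal chain of modular flats $\emptyset=F_0\subsetneq F_1\subsetneq\dots\subsetneq F_r=[n]$ (an $M$-chain); the associated $M$-partition is $P_i=F_i\setminus F_{i-1}$, $i=1,\dots,r$. A line is a flat of rank 2; it is nontrivial if it has at least three elements. The S-graph $G_{\mathcal P}$ has vertex set $\{P_1,\dots,P_r\}$, and $\{P_i,P_j\}$ ($i\ne j$) is an edge iff some nontrivial line of $M$ meets both $P_i$ and $P_j$. A graph is chordal if every cycle of length at least four has a chord. *)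

theory Defs
  imports Main "HOL-Library.Disjoint_Sets"
begin

definition matroid :: "'a set \<Rightarrow> ('a set \<Rightarrow> bool) \<Rightarrow> bool" where
  "matroid E indep \<longleftrightarrow>
     finite E \<and>
     (\<forall>I. indep I \<longrightarrow> I \<subseteq> E) \<and>
     indep {} \<and>
     (\<forall>I J. indep I \<and> J \<subseteq> I \<longrightarrow> indep J) \<and>
     (\<forall>I J. indep I \<and> indep J \<and> card I < card J \<longrightarrow> (\<exists>x\<in>J - I. indep (insert x I)))"

definition circuit :: "'a set \<Rightarrow> ('a set \<Rightarrow> bool) \<Rightarrow> 'a set \<Rightarrow> bool" where
  "circuit E indep C \<longleftrightarrow> C \<subseteq> E \<and> \<not> indep C \<and> (\<forall>D. D \<subset> C \<longrightarrow> indep D)"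

definition rank :: "('a set \<Rightarrow> bool) \<Rightarrow> 'a set \<Rightarrow> nat" where
  "rank indep X = Max (card ` {I. I \<subseteq> X \<and> indep I})"

definition closure :: "'a set \<Rightarrow> ('a set \<Rightarrow> bool) \<Rightarrow> 'a set \<Rightarrow> 'a set" where
  "closure E indep X = {x\<in>E. rank indep (insert x X) = rank indep X}"

definition flat :: "'a set \<Rightarrow> ('a set \<Rightarrow> bool) \<Rightarrow> 'a set \<Rightarrow> bool" where
  "flat E indep F \<longleftrightarrow> F \<subseteq> E \<and> closure E indep F = F"

definition simple_matroid :: "'a set \<Rightarrow> ('a set \<Rightarrow> bool) \<Rightarrow> bool" where
  "simple_matroid E indep \<longleftrightarrow> (\<forall>C. circuit E indep C \<longrightarrow> 3 \<le> card C)"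

definition binary_matroid :: "'a set \<Rightarrow> ('a set \<Rightarrow> bool) \<Rightarrow> bool" where
  "binary_matroid E indep \<longleftrightarrow>
     (\<forall>C D. circuit E indep C \<and> circuit E indep D \<and> C \<noteq> D \<longrightarrow>
        (\<exists>\<C>. (\<forall>B\<in>\<C>. circuit E indep B) \<and> disjoint \<C> \<and> \<Union>\<C> = (C - D) \<union> (D - C)))"

text \<open>In the lattice of flats, the join is the closure of the union and the meet is the
  intersection.\<close>

definition modular_pair :: "'a set \<Rightarrow> ('a set \<Rightarrow> bool) \<Rightarrow> 'a set \<Rightarrow> 'a set \<Rightarrow> bool" where
  "modular_pair E indep F G \<longleftrightarrow>
     rank indep F + rank indep G =
     rank indep (closure E indep (F \<union> G)) + rank indep (F \<inter> G)"

definition modular_flat :: "'a set \<Rightarrow> ('a set \<Rightarrow> bool) \<Rightarrow> 'a set \<Rightarrow> bool" where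
  "modular_flat E indep F \<longleftrightarrow>
     flat E indep F \<and> (\<forall>G. flat E indep G \<longrightarrow> modular_pair E indep F G)"

text \<open>A strict chain of flats from the empty set to \<open>E\<close> with as many steps as the rank of the
  matroid is automatically a maximal chain, so maximality needs no separate clause.  Only the
  values \<open>F 0, \<dots>, F r\<close>, where \<open>r\<close> is the rank, are relevant.\<close>

definition M_chain :: "'a set \<Rightarrow> ('a set \<Rightarrow> bool) \<Rightarrow> (nat \<Rightarrow> 'a set) \<Rightarrow> bool" where
  "M_chain E indep F \<longleftrightarrow>
     F 0 = {} \<and> F (rank indep E) = E \<and>
     (\<forall>i\<le>rank indep E. modular_flat E indep (F i)) \<and>
     (\<forall>i<rank indep E. F i \<subset> F (Suc i))"

definition supersolvable :: "'a set \<Rightarrow> ('a set \<Rightarrow> bool) \<Rightarrow> bool" where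
  "supersolvable E indep \<longleftrightarrow> (\<exists>F. M_chain E indep F)"

definition M_partition :: "'a set \<Rightarrow> ('a set \<Rightarrow> bool) \<Rightarrow> (nat \<Rightarrow> 'a set) \<Rightarrow> bool" where
  "M_partition E indep P \<longleftrightarrow>
     (\<exists>F. M_chain E indep F \<and> (\<forall>i\<in>{1..rank indep E}. P i = F i - F (i - 1)))"

definition nontrivial_line :: "'a set \<Rightarrow> ('a set \<Rightarrow> bool) \<Rightarrow> 'a set \<Rightarrow> bool" where
  "nontrivial_line E indep L \<longleftrightarrow> flat E indep L \<and> rank indep L = 2 \<and> 3 \<le> card L"

text \<open>A simple graph is a pair of a vertex set and a set of two-element sets of vertices.\<close>

type_synonym 'v sgraph = "'v set \<times> 'v set set"

definition S_graph ::
  "'a set \<Rightarrow> ('a set \<Rightarrow> bool) \<Rightarrow> (nat \<Rightarrow> 'a set) \<Rightarrow> 'a set sgraph" where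
  "S_graph E indep P =
     (P ` {1..rank indep E},
      {{P i, P j} | i j. i \<in> {1..rank indep E} \<and> j \<in> {1..rank indep E} \<and> i \<noteq> j \<and>
         (\<exists>L. nontrivial_line E indep L \<and> L \<inter> P i \<noteq> {} \<and> L \<inter> P j \<noteq> {})})"

text \<open>A cycle is given by the cyclic list of its distinct vertices.\<close>

definition graph_cycle :: "'v sgraph \<Rightarrow> 'v list \<Rightarrow> bool" where
  "graph_cycle G vs \<longleftrightarrow>
     3 \<le> length vs \<and> distinct vs \<and> set vs \<subseteq> fst G \<and>
     (\<forall>i<length vs. {vs ! i, vs ! (Suc i mod length vs)} \<in> snd G)"

definition has_chord :: "'v sgraph \<Rightarrow> 'v list \<Rightarrow> bool" where
  "has_chord G vs \<longleftrightarrow>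
     (\<exists>i<length vs. \<exists>j<length vs.
        i \<noteq> j \<and> j \<noteq> Suc i mod length vs \<and> i \<noteq> Suc j mod length vs \<and> {vs ! i, vs ! j} \<in> snd G)"

definition chordal :: "'v sgraph \<Rightarrow> bool" where
  "chordal G \<longleftrightarrow> (\<forall>vs. graph_cycle G vs \<and> 4 \<le> length vs \<longrightarrow> has_chord G vs)"

end

theory Submission imports Defs begin

text \<open>In a binary matroid, think of a three-element circuit as a relation \<open>x + y + z = 0\<close>.
  By modularity of \<open>F (k - 1)\<close>, any two elements of \<open>P k\<close> have their sum in \<open>F (k - 1)\<close>.
  Suppose \<open>i < j < k\<close>, with \<open>P i\<close> and \<open>P j\<close> adjacent to \<open>P k\<close>: there are \<open>b, b + a, d, d + e\<close> in
  \<open>P k\<close> with \<open>a \<in> P i\<close> and \<open>e \<in> P j\<close>. Then \<open>f = b + d\<close>, \<open>f + a\<close>, \<open>f + e\<close> and \<open>f + a + e\<close> lie in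
  \<open>F (k - 1)\<close>. According to whether \<open>f\<close> lies below, in or above \<open>P j\<close>, the relation between
  \<open>f + e, a, f + a + e\<close>, the one between \<open>f, a, f + a\<close>, or the one between \<open>a, e, a + e\<close> joins
  \<open>P i\<close> and \<open>P j\<close>. Hence removing the parts in decreasing order of index is a perfect elimination,
  and the two neighbours on a cycle of its part of largest index span a chord.\<close>

section \<open>Rank, closure and flats of a finite matroid\<close>

locale finite_matroid =
  fixes E :: "'a set" and indep :: "'a set \<Rightarrow> bool"
  assumes is_matroid: "matroid E indep"
begin

abbreviation "rk \<equiv> rank indep"
abbreviation "cl \<equiv> closure E indep"

lemma finite_ground: "finite E"
  and indep_subset: "indep I \<Longrightarrow> I \<subseteq> E"
  and indep_empty: "indep {}"
  and indep_mono: "indep I \<Longrightarrow> J \<subseteq> I \<Longrightarrow> indep J"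
  and indep_augment: "indep I \<Longrightarrow> indep J \<Longrightarrow> card I < card J \<Longrightarrow> \<exists>x\<in>J - I. indep (insert x I)"
  using is_matroid unfolding matroid_def by blast+

lemma finite_indep: "indep I \<Longrightarrow> finite I"
  using finite_ground indep_subset finite_subset by blast

lemma finite_indep_cards: "finite (card ` {I. I \<subseteq> X \<and> indep I})"
proof -
  have "{I. I \<subseteq> X \<and> indep I} \<subseteq> Pow E" using indep_subset by blast
  then show ?thesis using finite_ground finite_subset by blast
qed

lemma card_le_rank: "I \<subseteq> X \<Longrightarrow> indep I \<Longrightarrow> card I \<le> rk X"
  unfolding rank_def by (rule Max_ge[OF finite_indep_cards]) blast

lemma basis_exists:
  obtains B where "B \<subseteq> X" "indep B" "card B = rk X"
proof -
  have "rk X \<in> card ` {I. I \<subseteq> X \<and> indep I}"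
    unfolding rank_def using indep_empty by (intro Max_in[OF finite_indep_cards]) blast
  then show ?thesis using that by auto
qed

lemma rank_mono: "X \<subseteq> Y \<Longrightarrow> rk X \<le> rk Y"
  by (metis basis_exists card_le_rank order_trans)

lemma rank_indep: "indep X \<Longrightarrow> rk X = card X"
  by (metis basis_exists card_le_rank card_mono finite_indep le_antisym order_refl)

lemma basis_extension:
  assumes "indep I" "I \<subseteq> Y"
  obtains B where "I \<subseteq> B" "B \<subseteq> Y" "indep B" "card B = rk Y"
proof -
  have "\<exists>B. I \<subseteq> B \<and> B \<subseteq> Y \<and> indep B \<and> card B = rk Y"
    using assms
  proof (induction "rk Y - card I" arbitrary: I rule: less_induct)
    case less
    show ?case
    proof (cases "card I = rk Y")
      case True
      then show ?thesis using less.prems by blast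
    next
      case False
      then have lt: "card I < rk Y" using card_le_rank[of I Y] less.prems by simp
      obtain J where J: "J \<subseteq> Y" "indep J" "card J = rk Y" by (rule basis_exists)
      then obtain x where x: "x \<in> J - I" "indep (insert x I)"
        using indep_augment[of I J] less.prems(1) lt by auto
      then have "rk Y - card (insert x I) < rk Y - card I"
        using lt finite_indep[OF less.prems(1)] by simp
      moreover have "insert x I \<subseteq> Y" using x J less.prems by blast
      ultimately obtain B where "insert x I \<subseteq> B \<and> B \<subseteq> Y \<and> indep B \<and> card B = rk Y"
        using less.hyps[of "insert x I"] x(2) by auto
      then show ?thesis by blast
    qed
  qed
  then show ?thesis using that by blast
qed

text \<open>Suppose \<open>z\<close> raised the rank of \<open>Y\<close>. Extend a basis
  \<open>A\<close> of \<open>X\<close> to a basis \<open>B\<close> of \<open>Y\<close>; augmenting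
  \<open>B\<close> can only add \<open>z\<close>, since no element of \<open>Y\<close> enlarges it.
  Then \<open>insert z A\<close> is independent, so \<open>z\<close> raises the rank of
  \<open>X\<close> too.\<close>

lemma rank_insert_eq_mono:
  assumes "X \<subseteq> Y" "rk (insert z X) = rk X"
  shows "rk (insert z Y) = rk Y"
proof (rule ccontr)
  assume "rk (insert z Y) \<noteq> rk Y"
  then have lt: "rk Y < rk (insert z Y)" using rank_mono[of Y "insert z Y"] by (simp add: subset_insertI)
  obtain A where A: "A \<subseteq> X" "indep A" "card A = rk X" by (rule basis_exists)
  then obtain B where B: "A \<subseteq> B" "B \<subseteq> Y" "indep B" "card B = rk Y"
    using basis_extension[of A Y] assms(1) by blast
  obtain J where J: "J \<subseteq> insert z Y" "indep J" "card J = rk (insert z Y)" by (rule basis_exists)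
  obtain w where w: "w \<in> J - B" "indep (insert w B)"
    using indep_augment[of B J] B J lt by auto
  have "w \<notin> Y"
  proof
    assume "w \<in> Y"
    then have "card (insert w B) \<le> rk Y" using card_le_rank[of "insert w B" Y] B(2) w(2) by simp
    then show False using w B(4) finite_indep[OF B(3)] by simp
  qed
  then have "w = z" using w J by auto
  then have "indep (insert z A)" "z \<notin> A" using w B indep_mono[of "insert w B"] by blast+
  then have "card (insert z A) \<le> rk (insert z X)" "card (insert z A) = Suc (card A)"
    using card_le_rank[of "insert z A" "insert z X"] A(1) finite_indep[OF A(2)] by auto
  then show False using A assms(2) by simp
qed

lemma closure_mono: "X \<subseteq> Y \<Longrightarrow> cl X \<subseteq> cl Y"
  unfolding closure_def using rank_insert_eq_mono[of X Y] by auto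

lemma subset_closure: "X \<subseteq> E \<Longrightarrow> X \<subseteq> cl X"
  unfolding closure_def by (auto simp: insert_absorb)

lemma closure_subset_flat: "X \<subseteq> F \<Longrightarrow> flat E indep F \<Longrightarrow> cl X \<subseteq> F"
  using closure_mono unfolding flat_def by blast

text \<open>Otherwise some \<open>w\<close> in the closure would augment a basis of
  \<open>X\<close>, although adding \<open>w\<close> to \<open>X\<close> leaves the rank
  unchanged.\<close>

lemma rank_closure:
  assumes "X \<subseteq> E"
  shows "rk (cl X) = rk X"
proof (rule ccontr)
  assume "rk (cl X) \<noteq> rk X"
  then have lt: "rk X < rk (cl X)"
    using rank_mono[OF subset_closure[OF assms]] by simp
  obtain B where B: "B \<subseteq> X" "indep B" "card B = rk X" by (rule basis_exists)
  obtain J where J: "J \<subseteq> cl X" "indep J" "card J = rk (cl X)" by (rule basis_exists)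
  obtain w where w: "w \<in> J - B" "indep (insert w B)"
    using indep_augment[of B J] B J lt by auto
  have "card (insert w B) \<le> rk (insert w X)"
    using card_le_rank[of "insert w B" "insert w X"] B(1) w(2) by auto
  moreover have "rk (insert w X) = rk X" using w J unfolding closure_def by auto
  moreover have "card (insert w B) = Suc (card B)" using w finite_indep[OF B(2)] by simp
  ultimately show False using B by simp
qed

lemma flat_closure:
  assumes "X \<subseteq> E"
  shows "flat E indep (cl X)"
proof -
  have sub: "cl X \<subseteq> E" unfolding closure_def by blast
  \<comment> \<open>Idempotence by squeezing:
    \<open>rk X \<le> rk (insert z X) \<le> rk (insert z (cl X)) = rk X\<close>.\<close>
  have "z \<in> cl X" if "z \<in> cl (cl X)" for z
  proof -
    have "z \<in> E" "rk (insert z (cl X)) = rk X"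
      using that rank_closure[OF assms] unfolding closure_def by auto
    moreover have "rk (insert z X) \<le> rk (insert z (cl X))"
      using subset_closure[OF assms] by (intro rank_mono) blast
    moreover have "rk X \<le> rk (insert z X)" by (intro rank_mono) blast
    ultimately show ?thesis unfolding closure_def by simp
  qed
  then show ?thesis unfolding flat_def using sub subset_closure[OF sub] by blast
qed

lemma rank_flat_strict_mono:
  assumes "flat E indep F" "flat E indep G" "F \<subset> G"
  shows "rk F < rk G"
proof -
  obtain x where x: "x \<in> G" "x \<notin> F" using assms(3) by blast
  then have "x \<in> E" using assms(2) unfolding flat_def by blast
  then have "rk (insert x F) \<noteq> rk F" using x assms(1) unfolding flat_def closure_def by blast
  moreover have "rk F \<le> rk (insert x F)" "rk (insert x F) \<le> rk G"
    using rank_mono[of F "insert x F"] rank_mono[of "insert x F" G] assms(3) x by auto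
  ultimately show ?thesis by simp
qed

lemma dependent_contains_circuit:
  assumes "X \<subseteq> E" "\<not> indep X"
  obtains C where "C \<subseteq> X" "circuit E indep C"
proof -
  have "finite X" using assms finite_ground finite_subset by blast
  then have "\<exists>C \<subseteq> X. circuit E indep C" using assms
  proof (induction X rule: finite_psubset_induct)
    case (psubset X)
    show ?case
    proof (cases "\<forall>D. D \<subset> X \<longrightarrow> indep D")
      case True
      then show ?thesis using psubset.prems unfolding circuit_def by blast
    next
      case False
      then obtain D where "D \<subset> X" "\<not> indep D" by blast
      then show ?thesis using psubset.IH[of D] psubset.prems by blast
    qed
  qed
  then show ?thesis using that by blast
qed

end

section \<open>Three-element circuits of a simple binary matroid\<close>

locale simple_binary_matroid = finite_matroid E indep
  for E :: "'a set" and indep +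
  assumes simple: "simple_matroid E indep"
    and binary: "binary_matroid E indep"
begin

abbreviation "triangle x y z \<equiv> circuit E indep {x, y, z}"

lemma circuit_card: "circuit E indep C \<Longrightarrow> 3 \<le> card C"
  using simple unfolding simple_matroid_def by blast

lemma triangle_distinct: "triangle x y z \<Longrightarrow> distinct [x, y, z]"
  using circuit_card[of "{x, y, z}"] by (auto simp: card_insert_if split: if_splits)

lemma triangle_subset: "triangle x y z \<Longrightarrow> x \<in> E \<and> y \<in> E \<and> z \<in> E"
  unfolding circuit_def by blast

lemma triangle_rotate: "triangle x y z \<Longrightarrow> triangle y z x"
  by (simp add: insert_commute)

lemma triangle_swap: "triangle x y z \<Longrightarrow> triangle y x z"
  by (simp add: insert_commute)

lemma indep_if_card_le_2:
  assumes "X \<subseteq> E" "card X \<le> 2"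
  shows "indep X"
proof (rule ccontr)
  assume "\<not> indep X"
  then obtain C where C: "C \<subseteq> X" "circuit E indep C"
    using dependent_contains_circuit assms by blast
  then have "card C \<le> card X"
    using card_mono assms finite_ground finite_subset by metis
  then show False using circuit_card[OF C(2)] assms by simp
qed

lemma circuit_if_card_3:
  assumes "X \<subseteq> E" "card X = 3" "\<not> indep X"
  shows "circuit E indep X"
proof -
  have "indep D" if "D \<subset> X" for D
  proof -
    have "finite X" using assms(1) finite_ground finite_subset by blast
    then have "card D < card X" using that psubset_card_mono by blast
    then show ?thesis using indep_if_card_le_2[of D] that assms by auto
  qed
  then show ?thesis using assms unfolding circuit_def by blast
qed

lemma triangle_in_rank_2:
  assumes "x \<in> L" "y \<in> L" "z \<in> L" "distinct [x, y, z]" "L \<subseteq> E" "rk L = 2"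
  shows "triangle x y z"
proof (rule circuit_if_card_3)
  show "card {x, y, z} = 3" using assms by simp
  then show "\<not> indep {x, y, z}" using card_le_rank[of "{x, y, z}" L] assms by auto
qed (use assms in auto)

lemma rank_line:
  assumes "x \<in> E" "y \<in> E" "x \<noteq> y"
  shows "rk (cl {x, y}) = 2"
  using assms rank_closure[of "{x, y}"] rank_indep[of "{x, y}"] indep_if_card_le_2[of "{x, y}"]
  by simp

lemma triangle_in_line:
  assumes "triangle x y z"
  shows "z \<in> cl {x, y}"
proof -
  have d: "distinct [x, y, z]" and E: "x \<in> E" "y \<in> E" "z \<in> E"
    using triangle_distinct triangle_subset assms by blast+
  have i: "indep {x, y}" using indep_if_card_le_2[of "{x, y}"] d E by simp
  obtain B where B: "B \<subseteq> {z, x, y}" "indep B" "card B = rk {z, x, y}" by (rule basis_exists)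
  \<comment> \<open>A circuit is dependent, so a basis of it is a proper subset; hence
    \<open>z\<close> does not raise the rank 2 of \<open>{x, y}\<close>.\<close>
  have "B \<noteq> {z, x, y}" using B assms unfolding circuit_def by (auto simp: insert_commute)
  then have "card B < card {z, x, y}" using B by (intro psubset_card_mono) auto
  moreover have "card {z, x, y} = 3" using d by auto
  ultimately have "rk {z, x, y} \<le> 2" using B(3) by simp
  moreover have "rk {x, y} = 2" using rank_indep[OF i] d by simp
  moreover have "rk {x, y} \<le> rk {z, x, y}" by (intro rank_mono) blast
  ultimately show ?thesis using E unfolding closure_def by simp
qed

lemma triangle_in_flat:
  "triangle x y z \<Longrightarrow> flat E indep F \<Longrightarrow> x \<in> F \<Longrightarrow> y \<in> F \<Longrightarrow> z \<in> F"
  using triangle_in_line closure_subset_flat[of "{x, y}" F] by blast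

text \<open>Two disjoint circuits would need at least six elements.\<close>

lemma small_symmetric_difference_circuit:
  assumes C: "circuit E indep C" and D: "circuit E indep D" and "C \<noteq> D"
    and small: "card ((C - D) \<union> (D - C)) < 6"
  shows "circuit E indep ((C - D) \<union> (D - C))"
proof -
  let ?S = "(C - D) \<union> (D - C)"
  obtain \<C> where circ: "\<forall>B\<in>\<C>. circuit E indep B" and dis: "disjoint \<C>" and un: "\<Union>\<C> = ?S"
    using binary assms unfolding binary_matroid_def by meson
  have "?S \<noteq> {}" using \<open>C \<noteq> D\<close> by blast
  then obtain B where B: "B \<in> \<C>" using un by fastforce
  have finS: "finite ?S"
    using C D finite_ground unfolding circuit_def by (meson finite_Diff finite_UnI finite_subset)
  have "B' = B" if B': "B' \<in> \<C>" for B'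
  proof (rule ccontr)
    assume "B' \<noteq> B"
    then have "B \<inter> B' = {}" using dis B B' unfolding disjoint_def by blast
    moreover have sub: "B \<union> B' \<subseteq> ?S" using un B B' by blast
    ultimately have "card B + card B' \<le> card ?S"
      using finS by (metis card_Un_disjoint card_mono finite_Un finite_subset)
    then show False using circuit_card[of B] circuit_card[of B'] circ B B' small by fastforce
  qed
  then have "\<C> = {B}" using B by blast
  then show ?thesis using un circ by simp
qed

text \<open>The third point is the sum \<open>x + y\<close>. Two different third points would leave
  \<open>{z, w}\<close> as symmetric difference, a two-element circuit, against simplicity.\<close>

lemma triangle_unique:
  assumes "triangle x y z" "triangle x y w"
  shows "z = w"
proof (rule ccontr)
  assume "z \<noteq> w"
  moreover have "distinct [x, y, z]" "distinct [x, y, w]" using assms triangle_distinct by blast+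
  ultimately have S: "({x, y, z} - {x, y, w}) \<union> ({x, y, w} - {x, y, z}) = {z, w}" by auto
  then have "{x, y, z} \<noteq> {x, y, w}" by blast
  then have "circuit E indep {z, w}"
    using small_symmetric_difference_circuit[OF assms] S \<open>z \<noteq> w\<close> by simp
  then show False using circuit_card \<open>z \<noteq> w\<close> by fastforce
qed

text \<open>The complete quadrilateral: with \<open>z = x + y\<close>, \<open>v = x + u\<close> and \<open>w = y + u\<close>, one has
  \<open>z + v = w\<close>.\<close>

lemma triangle_quadrilateral:
  assumes xyz: "triangle x y z" and xuv: "triangle x u v" and yuw: "triangle y u w"
    and "w \<noteq> x"
  shows "triangle z v w"
proof -
  have d: "distinct [x, y, z]" "distinct [x, u, v]" "distinct [y, u, w]"
    using assms triangle_distinct by blast+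
  \<comment> \<open>If \<open>w = x\<close>, all three triangles are the same set and nothing
    remains after adding them. The hypothesis \<open>w \<noteq> x\<close> excludes this, first in
    the forms \<open>y = v\<close> and \<open>z = u\<close>.\<close>
  have "y \<noteq> v"
  proof
    assume "y = v"
    then have "triangle x y u" using xuv by (simp add: insert_commute)
    then have "triangle y u x" by (rule triangle_rotate)
    then show False using triangle_unique[OF yuw] \<open>w \<noteq> x\<close> by blast
  qed
  moreover have "z \<noteq> u"
  proof
    assume "z = u"
    then have "triangle y u x" using xyz by (simp add: insert_commute)
    then show False using triangle_unique[OF yuw] \<open>w \<noteq> x\<close> by blast
  qed
  moreover have "z \<noteq> v"
  proof
    assume "z = v"
    then have "triangle x z u" "triangle x z y" using xyz xuv by (simp_all add: insert_commute)
    then show False using triangle_unique d by auto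
  qed
  ultimately have d4: "distinct [y, z, u, v]" using d by auto
  \<comment> \<open>Adding the first two relations cancels \<open>x\<close> and leaves a circuit of
    four elements; adding the third then cancels \<open>y\<close> and \<open>u\<close>. Both
    symmetric differences have fewer than six elements.\<close>
  have S: "({x, y, z} - {x, u, v}) \<union> ({x, u, v} - {x, y, z}) = {y, z, u, v}"
    using d d4 by auto
  then have "{x, y, z} \<noteq> {x, u, v}" by blast
  then have quad: "circuit E indep {y, z, u, v}"
    using small_symmetric_difference_circuit[OF xyz xuv] S d4 by simp
  have "w \<noteq> z"
  proof
    assume "w = z"
    then have "triangle y z x" "triangle y z u" using xyz yuw by (simp_all add: insert_commute)
    then show False using triangle_unique d by auto
  qed
  moreover have "w \<noteq> v"
  proof
    assume "w = v"
    then have "triangle u v x" "triangle u v y" using xuv yuw by (simp_all add: insert_commute)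
    then show False using triangle_unique d by auto
  qed
  ultimately have S': "({y, z, u, v} - {y, u, w}) \<union> ({y, u, w} - {y, z, u, v}) = {z, v, w}"
    and "card {z, v, w} = 3" using d d4 by auto
  moreover from S' have "{y, z, u, v} \<noteq> {y, u, w}" by blast
  ultimately show ?thesis using small_symmetric_difference_circuit[OF quad yuw] by simp
qed

end

section \<open>The chain of modular flats and its parts\<close>

locale binary_M_chain = simple_binary_matroid E indep
  for E :: "'a set" and indep +
  fixes F P :: "nat \<Rightarrow> 'a set"
  assumes chain: "M_chain E indep F"
    and part: "\<And>i. i \<in> {1..rank indep E} \<Longrightarrow> P i = F i - F (i - 1)"
begin

abbreviation "R \<equiv> {1..rank indep E}"

lemma chain_flat: "i \<le> rk E \<Longrightarrow> flat E indep (F i)"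
  and chain_step: "i < rk E \<Longrightarrow> F i \<subset> F (Suc i)"
  and chain_0: "F 0 = {}"
  and chain_top: "F (rk E) = E"
  using chain unfolding M_chain_def modular_flat_def by auto

lemma chain_mono:
  assumes "i \<le> j" "j \<le> rk E"
  shows "F i \<subseteq> F j"
  using assms
proof (induction j rule: dec_induct)
  case (step m)
  then show ?case using chain_step[of m] by auto
qed simp

text \<open>The rank grows strictly at each of the \<open>rk E\<close> steps and ends at
  \<open>rk E\<close>, so it starts at 0 and every step adds exactly one.\<close>

lemma rank_chain:
  assumes "i \<le> rk E"
  shows "rk (F i) = i"
proof -
  have step: "rk (F i) < rk (F (Suc i))" if "i < rk E" for i
    using rank_flat_strict_mono chain_flat chain_step that by simp
  have lower: "i \<le> rk (F i)" if "i \<le> rk E" for i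
    using that
  proof (induction i)
    case (Suc i)
    then show ?case using step[of i] by simp
  qed simp
  have "rk (F i) + (j - i) \<le> rk (F j)" if "i \<le> j" "j \<le> rk E" for j
    using that
  proof (induction j rule: dec_induct)
    case (step m)
    then show ?case using \<open>\<And>i. i < rk E \<Longrightarrow> rk (F i) < rk (F (Suc i))\<close>[of m] by simp
  qed simp
  from this[of "rk E"] have "rk (F i) + (rk E - i) \<le> rk E" using assms chain_top by simp
  then show ?thesis using lower[OF assms] assms by simp
qed

lemma part_flat: "i \<in> R \<Longrightarrow> flat E indep (F i)"
  and part_lower_flat: "i \<in> R \<Longrightarrow> flat E indep (F (i - 1))"
  by (rule chain_flat; force)+

lemma part_lower_psubset:
  assumes "i \<in> R"
  shows "F (i - 1) \<subset> F i"
proof -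
  have "i - 1 < rk E" "Suc (i - 1) = i" using assms by auto
  then show ?thesis using chain_step by metis
qed

lemma part_subset: "i \<in> R \<Longrightarrow> P i \<subseteq> E"
  using part chain_flat[of i] unfolding flat_def by auto

lemma part_nonempty: "i \<in> R \<Longrightarrow> P i \<noteq> {}"
  using part part_lower_psubset by blast

lemma part_below:
  assumes "i < j" "j \<in> R" "i \<in> R"
  shows "P i \<subseteq> F (j - 1)"
proof -
  have "i \<le> j - 1" "j - 1 \<le> rk E" using assms by auto
  then show ?thesis using part[OF assms(3)] chain_mono by blast
qed

lemma part_disjoint_less: "i < j \<Longrightarrow> i \<in> R \<Longrightarrow> j \<in> R \<Longrightarrow> P i \<inter> P j = {}"
  using part_below part by blast

lemma part_inj: "inj_on P R"
proof (rule inj_onI)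
  fix i j assume ij: "i \<in> R" "j \<in> R" "P i = P j"
  show "i = j"
  proof (rule ccontr)
    assume "i \<noteq> j"
    then have "P i \<inter> P j = {}" using part_disjoint_less ij by (metis Int_commute nat_neq_iff)
    then show False using part_nonempty ij by auto
  qed
qed

lemma obtain_level:
  assumes "x \<in> F k" "k \<le> rk E"
  obtains m where "m \<in> R" "x \<in> P m"
proof -
  \<comment> \<open>The least index at which \<open>x\<close> appears. It is positive because
    \<open>F 0\<close> is empty, so \<open>m - 1\<close> is a genuine predecessor and
    \<open>x\<close> is new at \<open>m\<close>.\<close>
  define m where "m = (LEAST m. x \<in> F m)"
  have xm: "x \<in> F m" unfolding m_def using assms(1) by (rule LeastI)
  have mk: "m \<le> k" unfolding m_def using assms(1) by (rule Least_le)
  have "m \<noteq> 0" using xm chain_0 by (metis empty_iff)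
  then have "m - 1 < (LEAST m. x \<in> F m)" unfolding m_def by simp
  then have "x \<notin> F (m - 1)" by (rule not_less_Least)
  then have "m \<in> R" "x \<in> P m" using xm mk assms(2) \<open>m \<noteq> 0\<close> part[of m] by auto
  then show ?thesis using that by blast
qed

text \<open>Adding an element of \<open>F (k - 1)\<close> does not leave \<open>P k\<close>: the sum
  stays in the flat \<open>F k\<close>, and if it fell into the flat \<open>F (k - 1)\<close>, so
  would \<open>y\<close>.\<close>

lemma triangle_above:
  assumes "triangle x y z" "k \<in> R" "x \<in> F (k - 1)" "y \<in> P k"
  shows "z \<in> P k"
proof -
  have fl: "flat E indep (F (k - 1))" "flat E indep (F k)"
    using part_flat part_lower_flat assms(2) by blast+
  have sub: "F (k - 1) \<subseteq> F k" using part_lower_psubset assms(2) by blast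
  have "y \<in> F k" "y \<notin> F (k - 1)" using assms part by auto
  moreover have "z \<in> F k"
    using triangle_in_flat[OF assms(1) fl(2)] sub assms \<open>y \<in> F k\<close> by blast
  moreover have "z \<notin> F (k - 1)"
    using triangle_in_flat[of z x y, OF _ fl(1)] assms(1,3) \<open>y \<notin> F (k - 1)\<close>
    by (auto simp: insert_commute)
  ultimately show ?thesis using part[OF assms(2)] by blast
qed

text \<open>A line spanned by two points of \<open>P k\<close> lies in \<open>F k\<close>, so it meets the modular
  hyperplane \<open>F (k - 1)\<close> of \<open>F k\<close>.\<close>

lemma part_pair_triangle:
  assumes k: "k \<in> R" and x: "x \<in> P k" and y: "y \<in> P k" and "x \<noteq> y"
  obtains z where "triangle x y z" "z \<in> F (k - 1)"
proof -
  have E: "x \<in> E" "y \<in> E" using part_subset assms by blast+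
  let ?L = "cl {x, y}"
  have L: "flat E indep ?L" using flat_closure E by simp
  have xyL: "x \<in> ?L" "y \<in> ?L" using subset_closure[of "{x, y}"] E by auto
  have fl: "flat E indep (F k)" using part_flat k by blast
  have "?L \<subseteq> F k" using closure_subset_flat[OF _ fl, of "{x, y}"] part k x y by blast
  moreover have "F (k - 1) \<subseteq> F k" using part_lower_psubset k by blast
  ultimately have "cl (F (k - 1) \<union> ?L) \<subseteq> F k" using closure_subset_flat fl by simp
  then have "rk (cl (F (k - 1) \<union> ?L)) \<le> rk (F k)" by (rule rank_mono)
  moreover have "rk (F k) = k" "rk (F (k - 1)) = k - 1" by (rule rank_chain; use k in force)+
  moreover have "modular_pair E indep (F (k - 1)) ?L"
  proof -
    have "k - 1 \<le> rk E" using k by auto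
    then show ?thesis using chain L unfolding M_chain_def modular_flat_def by blast
  qed
  moreover have "rk ?L = 2" using rank_line E \<open>x \<noteq> y\<close> by blast
  \<comment> \<open>Modularity gives the intersection rank at least
    \<open>(k - 1) + 2 - k = 1\<close>.\<close>
  ultimately have "rk (F (k - 1) \<inter> ?L) \<noteq> 0" unfolding modular_pair_def using k by auto
  then have "F (k - 1) \<inter> ?L \<noteq> {}" using rank_indep[OF indep_empty] by auto
  then obtain z where z: "z \<in> F (k - 1)" "z \<in> ?L" by blast
  then have "distinct [x, y, z]" using \<open>x \<noteq> y\<close> x y part k by auto
  then have "triangle x y z"
    using triangle_in_rank_2[of x ?L y z] xyL z L \<open>rk ?L = 2\<close> unfolding flat_def by blast
  then show ?thesis using that z by blast
qed

section \<open>Adjacency of parts by triangles, and the elimination property\<close>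

lemma triangle_of_common_point:
  assumes k: "k \<in> R" and b: "b \<in> P k" and a: "a \<in> F (k - 1)" and e: "e \<in> F (k - 1)"
    and "a \<noteq> e" and ba: "triangle b a b'" and be: "triangle b e d'"
  obtains w where "triangle a e w"
proof -
  have b': "b' \<in> P k" using triangle_above[OF triangle_swap[OF ba]] k b a by blast
  have d': "d' \<in> P k" using triangle_above[OF triangle_swap[OF be]] k b e by blast
  have bb': "triangle b b' a" and bd': "triangle b d' e"
    using ba be by (simp_all add: insert_commute)
  have "b' \<noteq> d'"
  proof
    assume "b' = d'"
    then have "triangle b b' e" using bd' by simp
    then show False using triangle_unique[OF bb'] \<open>a \<noteq> e\<close> by blast
  qed
  \<comment> \<open>With \<open>b' = b + a\<close> and \<open>d' = b + e\<close>, this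
    \<open>w\<close> is \<open>a + e\<close>. Lying in \<open>F (k - 1)\<close>, it differs from
    \<open>b\<close>, as the quadrilateral requires.\<close>
  then obtain w where w: "triangle b' d' w" "w \<in> F (k - 1)"
    using part_pair_triangle[OF k b' d'] by blast
  then have "w \<noteq> b" using b part[OF k] by auto
  then show ?thesis using that triangle_quadrilateral[OF bb' bd' w(1)] by blast
qed

text \<open>Edges of the S-graph in terms of indices, so that parts can be compared by their
  position in the chain, and with a triangle in place of a nontrivial line. The third point
  \<open>z\<close> may lie in any part.\<close>

definition adj :: "nat \<Rightarrow> nat \<Rightarrow> bool" where
  "adj i j \<longleftrightarrow> (\<exists>x y z. x \<in> P i \<and> y \<in> P j \<and> triangle x y z)"

lemma adj_sym: "adj i j \<Longrightarrow> adj j i"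
  unfolding adj_def using triangle_swap by blast

lemma adj_elimination:
  assumes R: "i \<in> R" "j \<in> R" "k \<in> R" and "i < j" "j < k" and "adj i k" "adj j k"
  shows "adj i j"
proof -
  obtain a b b' where a: "a \<in> P i" and b: "b \<in> P k" and abb': "triangle a b b'"
    using \<open>adj i k\<close> unfolding adj_def by blast
  obtain e d d' where e: "e \<in> P j" and d: "d \<in> P k" and edd': "triangle e d d'"
    using \<open>adj j k\<close> unfolding adj_def by blast
  have aF: "a \<in> F (k - 1)" and eF: "e \<in> F (k - 1)" and aj: "a \<in> F (j - 1)"
    using part_below a e R \<open>i < j\<close> \<open>j < k\<close> by (meson less_trans subsetD)+
  have b': "b' \<in> P k" using triangle_above abb' R aF b by blast
  have d': "d' \<in> P k" using triangle_above edd' R eF d by blast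
  have "a \<noteq> e" using a e part_disjoint_less R \<open>i < j\<close> by blast
  have bb': "triangle b b' a" and dd': "triangle d d' e"
    using abb' edd' by (simp_all add: insert_commute)
  have via_triangle: "adj i j" if "triangle a e w" for w using that a e unfolding adj_def by blast
  \<comment> \<open>A point \<open>x\<close> above \<open>P j\<close> to which both \<open>a\<close>
    and \<open>e\<close> can be added makes \<open>a + e\<close> exist. This is used with
    \<open>x\<close> in \<open>P k\<close> and again with \<open>x = f\<close>.\<close>
  have common: "adj i j" if "m \<in> R" "j < m" "x \<in> P m" "triangle x a y" "triangle x e z" for m x y z
  proof -
    have "a \<in> F (m - 1)" "e \<in> F (m - 1)"
      using part_below a e R \<open>i < j\<close> that by (meson less_trans subsetD)+
    then show ?thesis using triangle_of_common_point that \<open>a \<noteq> e\<close> via_triangle by metis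
  qed
  show ?thesis
  \<comment> \<open>If the pairs \<open>b, b'\<close> and \<open>d, d'\<close> share a point, that
    point serves as the common one. Otherwise the four points are distinct and all cross sums can be
    formed.\<close>
  proof (cases "b = d \<or> b = d' \<or> b' = d \<or> b' = d'")
    case True
    moreover have "triangle b a b'" "triangle b' a b" "triangle d e d'" "triangle d' e d"
      using bb' dd' by (simp_all add: insert_commute)
    ultimately show ?thesis using common[OF \<open>k \<in> R\<close> \<open>j < k\<close>] b b' by metis
  next
    case False
    have notF: "x \<notin> F (k - 1)" if "x \<in> P k" for x using that part R by auto
    \<comment> \<open>Since \<open>b' = b + a\<close> and \<open>d' = d + e\<close>, the four cross
      sums are \<open>f = b + d\<close>, \<open>g = f + a\<close>, \<open>h = f + e\<close> and
      \<open>l = f + a + e\<close>.\<close>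
    obtain f where f: "triangle b d f" "f \<in> F (k - 1)"
      using part_pair_triangle[OF \<open>k \<in> R\<close> b d] False by blast
    obtain g where g: "triangle d b' g" "g \<in> F (k - 1)"
      using part_pair_triangle[OF \<open>k \<in> R\<close> d b'] False by blast
    obtain h where h: "triangle b d' h" "h \<in> F (k - 1)"
      using part_pair_triangle[OF \<open>k \<in> R\<close> b d'] False by blast
    obtain l where l: "triangle d' b' l" "l \<in> F (k - 1)"
      using part_pair_triangle[OF \<open>k \<in> R\<close> d' b'] False by blast
    \<comment> \<open>Each of the next three quadrilaterals is nondegenerate because its last sum
      lies in \<open>F (k - 1)\<close> while its base point \<open>b\<close> or \<open>d\<close>
      does not.\<close>
    have fag: "triangle f a g"
      using triangle_quadrilateral[OF f(1) bb' g(1)] g(2) notF[OF b] by blast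
    have feh: "triangle f e h"
      using triangle_quadrilateral[OF triangle_swap[OF f(1)] dd' h(1)] h(2) notF[OF d] by blast
    have hal: "triangle h a l"
      using triangle_quadrilateral[OF h(1) bb' l(1)] l(2) notF[OF b] by blast
    have "k - 1 \<le> rk E" using R(3) by auto
    then obtain m where m: "m \<in> R" "f \<in> P m"
      using obtain_level[OF f(2)] by blast
    consider "m < j" | "m = j" | "j < m" by linarith
    then show ?thesis
    proof cases
      case 1
      then have "f \<in> F (j - 1)" using part_below m R by blast
      then have "h \<in> P j" using triangle_above[OF feh] R e by blast
      then show ?thesis using a triangle_swap[OF hal] unfolding adj_def by blast
    next
      case 2
      then show ?thesis using a m triangle_swap[OF fag] unfolding adj_def by blast
    next
      case 3
      then show ?thesis using common m fag feh by blast
    qed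
  qed
qed

section \<open>From triangles to the S-graph and its cycles\<close>

lemma adj_iff_line:
  assumes "i \<in> R" "j \<in> R" "i \<noteq> j"
  shows "adj i j \<longleftrightarrow> (\<exists>L. nontrivial_line E indep L \<and> L \<inter> P i \<noteq> {} \<and> L \<inter> P j \<noteq> {})"
proof
  assume "adj i j"
  then obtain x y z where xyz: "x \<in> P i" "y \<in> P j" "triangle x y z" unfolding adj_def by blast
  have d: "distinct [x, y, z]" and E: "x \<in> E" "y \<in> E"
    using triangle_distinct triangle_subset xyz(3) by blast+
  let ?L = "cl {x, y}"
  have L: "flat E indep ?L" using flat_closure E by simp
  have sub: "{x, y, z} \<subseteq> ?L" using subset_closure[of "{x, y}"] E triangle_in_line[OF xyz(3)] by auto
  have "finite ?L" using L finite_ground finite_subset unfolding flat_def by blast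
  then have "card {x, y, z} \<le> card ?L" using sub by (rule card_mono)
  moreover have "card {x, y, z} = 3" using d by simp
  moreover have "rk ?L = 2" using rank_line E d by simp
  ultimately have "nontrivial_line E indep ?L" using L unfolding nontrivial_line_def by simp
  then show "\<exists>L. nontrivial_line E indep L \<and> L \<inter> P i \<noteq> {} \<and> L \<inter> P j \<noteq> {}"
    using sub xyz by blast
next
  assume "\<exists>L. nontrivial_line E indep L \<and> L \<inter> P i \<noteq> {} \<and> L \<inter> P j \<noteq> {}"
  then obtain L x y where L: "flat E indep L" "rk L = 2" "3 \<le> card L"
    and xy: "x \<in> L" "x \<in> P i" "y \<in> L" "y \<in> P j" unfolding nontrivial_line_def by blast
  \<comment> \<open>Distinct parts are disjoint, so the two chosen points differ and a third point
    of the line completes a triangle.\<close>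
  have "x \<noteq> y" using xy part_disjoint_less assms by (metis disjoint_iff nat_neq_iff)
  have "\<not> L \<subseteq> {x, y}"
  proof
    assume "L \<subseteq> {x, y}"
    then have "card L \<le> card {x, y}" by (intro card_mono) auto
    then show False using L \<open>x \<noteq> y\<close> by simp
  qed
  then obtain z where "z \<in> L" "z \<noteq> x" "z \<noteq> y" by blast
  then have "triangle x y z"
    using triangle_in_rank_2[of x L y z] L xy \<open>x \<noteq> y\<close> unfolding flat_def by auto
  then show "adj i j" using xy unfolding adj_def by blast
qed

lemma S_graph_edge_iff:
  assumes "i \<in> R" "j \<in> R" "i \<noteq> j"
  shows "{P i, P j} \<in> snd (S_graph E indep P) \<longleftrightarrow> adj i j"
proof
  assume "{P i, P j} \<in> snd (S_graph E indep P)"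
  then obtain i' j' where *: "{P i, P j} = {P i', P j'}" "i' \<in> R" "j' \<in> R" "i' \<noteq> j'"
    and "\<exists>L. nontrivial_line E indep L \<and> L \<inter> P i' \<noteq> {} \<and> L \<inter> P j' \<noteq> {}"
    unfolding S_graph_def by auto
  then have "adj i' j'" using adj_iff_line by blast
  \<comment> \<open>An edge is an unordered pair of sets; injectivity of \<open>P\<close> on
    \<open>R\<close> recovers the indices up to order.\<close>
  moreover have "(i = i' \<and> j = j') \<or> (i = j' \<and> j = i')"
    using * assms part_inj unfolding doubleton_eq_iff inj_on_def by blast
  ultimately show "adj i j" using adj_sym by blast
next
  assume "adj i j"
  then show "{P i, P j} \<in> snd (S_graph E indep P)"
    using adj_iff_line[OF assms] assms unfolding S_graph_def snd_conv by blast
qed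

lemma chordal_S_graph: "chordal (S_graph E indep P)"
  unfolding chordal_def
proof (intro allI impI, elim conjE)
  fix vs assume cyc: "graph_cycle (S_graph E indep P) vs" and len: "4 \<le> length vs"
  let ?N = "length vs" and ?G = "S_graph E indep P"
  have dist: "distinct vs" and sub: "set vs \<subseteq> P ` R"
    and edge: "\<And>p. p < ?N \<Longrightarrow> {vs ! p, vs ! (Suc p mod ?N)} \<in> snd ?G"
    using cyc unfolding graph_cycle_def S_graph_def by auto
  define idx where "idx p = (SOME i. i \<in> R \<and> vs ! p = P i)" for p
  have idx: "idx p \<in> R" "vs ! p = P (idx p)" if "p < ?N" for p
  proof -
    have "\<exists>i. i \<in> R \<and> vs ! p = P i" using sub that nth_mem by blast
    then have "idx p \<in> R \<and> vs ! p = P (idx p)" unfolding idx_def by (rule someI_ex)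
    then show "idx p \<in> R" "vs ! p = P (idx p)" by blast+
  qed
  have idx_neq: "idx p \<noteq> idx q" if "p < ?N" "q < ?N" "p \<noteq> q" for p q
  proof -
    have "vs ! p \<noteq> vs ! q" using that dist by (simp add: nth_eq_iff_index_eq)
    then show ?thesis using idx(2) that by auto
  qed
  have edge_adj: "{vs ! p, vs ! q} \<in> snd ?G \<longleftrightarrow> adj (idx p) (idx q)"
    if "p < ?N" "q < ?N" "p \<noteq> q" for p q
    using S_graph_edge_iff[of "idx p" "idx q"] idx[OF that(1)] idx[OF that(2)] idx_neq[OF that]
    by simp
  have "Max (idx ` {..<?N}) \<in> idx ` {..<?N}"
    using len by (intro Max_in) (auto simp: lessThan_empty_iff)
  \<comment> \<open>The vertex of the cycle that is eliminated first; its two neighbours then have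
    smaller indices.\<close>
  then obtain p where p: "p < ?N" "idx p = Max (idx ` {..<?N})" by auto
  have max: "idx q < idx p" if "q < ?N" "q \<noteq> p" for q
  proof -
    have "idx q \<le> idx p" using p that by simp
    then show ?thesis using idx_neq[of q p] p(1) that by simp
  qed
  \<comment> \<open>\<open>q\<close> and \<open>s\<close> are the cyclic successor and predecessor
    of \<open>p\<close>; they will be the ends of the chord.\<close>
  define q where "q = Suc p mod ?N"
  define s where "s = (if p = 0 then ?N - 1 else p - 1)"
  have q_cases: "q = (if Suc p = ?N then 0 else Suc p)" unfolding q_def using p(1) by auto
  have qN: "q < ?N" and sN: "s < ?N" unfolding q_cases s_def using p(1) len by auto
  have sp: "Suc s mod ?N = p" unfolding s_def using p(1) len by auto
  have neq: "q \<noteq> p" "s \<noteq> p" "q \<noteq> s" unfolding q_cases s_def using p(1) len by auto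
  \<comment> \<open>Length at least four matters here: in a cycle of length three, \<open>s\<close>
    would follow \<open>q\<close> and the edge would not be a chord.\<close>
  have sq: "s \<noteq> Suc q mod ?N" unfolding q_cases s_def mod_Suc using p(1) len by auto
  have "adj (idx p) (idx q)" "adj (idx s) (idx p)"
    using edge[OF p(1)] edge[OF sN] edge_adj[of p q] edge_adj[of s p] qN sN p(1) neq sp
    by (simp_all add: q_def[symmetric])
  then have "adj (idx q) (idx p)" "adj (idx s) (idx p)" using adj_sym by blast+
  moreover have "idx q < idx p" "idx s < idx p" using max qN sN neq by blast+
  moreover have "idx s < idx q \<or> idx q < idx s" using idx_neq[of s q] qN sN neq by auto
  ultimately have "adj (idx s) (idx q)"
    using adj_elimination[of "idx s" "idx q" "idx p"] adj_elimination[of "idx q" "idx s" "idx p"]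
      idx(1)[OF qN] idx(1)[OF sN] idx(1)[OF p(1)] adj_sym by blast
  then have "{vs ! s, vs ! q} \<in> snd ?G" using edge_adj sN qN neq by simp
  then show "has_chord ?G vs"
    unfolding has_chord_def using sN qN neq sp sq by blast
qed

end

theorem theorem2p10:
  fixes n r :: nat and indep :: "nat set \<Rightarrow> bool" and P :: "nat \<Rightarrow> nat set"
  assumes "matroid {1..n} indep"
    and "simple_matroid {1..n} indep"
    and "binary_matroid {1..n} indep"
    and "supersolvable {1..n} indep"
    and "rank indep {1..n} = r"
    and "M_partition {1..n} indep P"
  shows "chordal (S_graph {1..n} indep P)"
proof -
  obtain F where "M_chain {1..n} indep F"
    and "\<forall>i\<in>{1..rank indep {1..n}}. P i = F i - F (i - 1)"
    using assms(6) unfolding M_partition_def by blast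
  then interpret binary_M_chain "{1..n}" indep F P
    using assms(1-3) by unfold_locales auto
  show ?thesis by (rule chordal_S_graph)
qed

end
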